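(* Let $(a_k),(b_k)$ be a Bregman alternating sequence between $A$ and $B$, with gap $(K^*,r^* )$. Suppose the $rl$-angle condition and the $rl$-three-point inequality are satisfied at every $(b^*,a^* )\in K^*$. Then the sequence $(b_k)$ (which satisfies $b_k\in \overleftarrow{P}_B\circ\overrightarrow{P}_A(b_{k-1})$) converges.
   Context: Setting: $f:\mathbb R^d\to\mathbb R\cup\{+\infty\}$ is a convex function of Legendre type (in Rockafellar's sense), $G:=\mathrm{int}(\mathrm{dom} f)$, $f$ is of class $C^2$ on $G$ and $\nabla^2f(x)\succ0$ for all $x\in G$. The Bregman distance is $D(x,y)=f(x)-f(y)-\langle\nabla f(y),x-y\rangle$ for $y\in G$ and $D(x,y)=+\infty$ otherwise. $A,B\subset G$ are nonempty, closed and bounded. Projections: $\overleftarrow{D}_B(a)=\min\{D(b',a):b'\in B\}$, $\overleftarrow{P}_B(a)=\mathrm{argmin}\{D(b',a):b'\in B\}$; $\overrightarrow{D}_A(b)=\min\{D(b,a'):a'\in A\}$, $\overrightarrow{P}_A(b)=\mathrm{argmin}\{D(b,a'):a'\in A\}$ (set-valued). A Bregman alternating sequence is $a_k\in A$, $b_k\in B$ with $b_k\in\overleftarrow{P}_B(a_k)$, $a_{k+1}\in\overrightarrow{P}_A(b_k)$ for all $k$. An $rl$-building block $b\to a^+\to b^+$ consists of $b\in B$, $a^+\in\overrightarrow{P}_A(b)$, $b^+\in\overleftarrow{P}_B(a^+)$. Gaps: for $b^*\in B$, $a^*\in A$ write $b^*\sim a^*$ (gap pair) if $a^*\in\overrightarrow{P}_A(b^*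 )$ and $b^*\in\overleftarrow{P}_B(a^* )$; its gap value is the $r^*\ge0$ with $D(b^*,a^* )=\frac12 r^{*2}$. For an alternating sequence, $D(b_k,a_k)$ decreases to a limit $\frac12r^{*2}$; with $A^*,B^*$ the sets of accumulation points of $(a_k)$, $(b_k)$, the gap of the sequence is $(K^*,r^* )$, $K^*=\{(b^*,a^* )\in B^*\times A^*: b^*\sim a^*\}$. De-singularizing function: a continuous concave $\phi:[0,\eta)\to\mathbb R_+$ with $\phi(0)=0$, $\phi$ of class $C^1$ on $(0,\eta)$, $\phi'>0$ on $(0,\eta)$. $rl$-angle condition at a gap pair $b^*\sim a^*$ with value $r^*$: there exist a neighborhood $W$ of $(b^*,a^* )$, constants $\gamma,\eta>0$ and a de-singularizing function $\phi:[0,\eta)\to\mathbb R_+$ such that the shrinking function $\sigma(s)=\phi'(s)^{-2}$ if $r^*>0$, respectively $\sigma(s)=\phi'(s)^{-2}s^{-1}$ if $r^*=0$, is nondecreasing and $$\frac{1-\cos\alpha}{\sigma(\overleftarrow{D}_B(a^+)-\frac12r^{*2})}\ge\gamma$$ for every $rl$-building block $b\to a^+\to b^+$ with $(b^+,a^+)\in W$ and $\frac12r^{*2}<D(b^+,a^+)<\frac12r^{*2}+\eta$, where $\alpha$ is the angle between $b-a^+$ and $b^+-a^+$. $rl$-three-point inequality at $(b^*,a^* )$: there exist $\ell\in(0,1)$ and $\delta>0$ such that $D(b,a^+)\ge D(b^+,a^+)+\ell D(b,b^+)$ for every $rl$-building block $b\to a^+\to b^+$ with $\|b^+-b^*\|<\delta$,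 $\|a^+-a^*\|<\delta$. *)

theory Defs
  imports "HOL-Analysis.Analysis"
begin

section \<open>Convex functions of Legendre type\<close>

definition dom :: "('a \<Rightarrow> ereal) \<Rightarrow> 'a set" where
  "dom f = {x. f x < \<infinity>}"

abbreviation int_dom :: "('a::topological_space \<Rightarrow> ereal) \<Rightarrow> 'a set" where
  "int_dom f \<equiv> interior (dom f)"

text \<open>The value \<open>-\<infinity>\<close> is excluded by \<open>proper_convex\<close>, so on \<open>dom f\<close> no information is
  lost by \<open>real_of_ereal\<close>.\<close>

definition proper_convex :: "('a::real_vector \<Rightarrow> ereal) \<Rightarrow> bool" where
  "proper_convex f \<longleftrightarrow>
     (\<forall>x. f x \<noteq> -\<infinity>) \<and> dom f \<noteq> {} \<and> convex {(x, \<mu>::real). f x \<le> ereal \<mu>}"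

definition grad :: "('a::real_inner \<Rightarrow> ereal) \<Rightarrow> 'a \<Rightarrow> 'a" where
  "grad f x = (THE g. GDERIV (\<lambda>z. real_of_ereal (f z)) x :> g)"

definition hessian :: "(real ^ 'd \<Rightarrow> ereal) \<Rightarrow> real ^ 'd \<Rightarrow> real ^ 'd ^ 'd" where
  "hessian f x = matrix (frechet_derivative (grad f) (at x))"

definition essentially_smooth :: "('a::real_inner \<Rightarrow> ereal) \<Rightarrow> bool" where
  "essentially_smooth f \<longleftrightarrow>
     int_dom f \<noteq> {} \<and>
     (\<forall>x\<in>int_dom f. (\<lambda>z. real_of_ereal (f z)) differentiable (at x)) \<and>
     (\<forall>u x. (\<forall>n::nat. u n \<in> int_dom f) \<longrightarrow> u \<longlonglongrightarrow> x \<longrightarrow> x \<in> frontier (int_dom f) \<longrightarrow>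
        filterlim (\<lambda>n. norm (grad f (u n))) at_top sequentially)"

text \<open>Rockafellar calls the pair \<open>(C, f)\<close>, with \<open>C\<close> the interior of the domain, of Legendre type
  if \<open>f\<close> is essentially smooth and strictly convex on \<open>C\<close>. Lower semicontinuity of \<open>f\<close> at boundary
  points of the domain is not part of that definition.\<close>

definition legendre_type :: "('a::real_inner \<Rightarrow> ereal) \<Rightarrow> bool" where
  "legendre_type f \<longleftrightarrow>
     proper_convex f \<and> essentially_smooth f \<and>
     (\<forall>x\<in>int_dom f. \<forall>y\<in>int_dom f. \<forall>t. x \<noteq> y \<longrightarrow> 0 < t \<longrightarrow> t < 1 \<longrightarrow>
        f ((1 - t) *\<^sub>R x + t *\<^sub>R y) < ereal (1 - t) * f x + ereal t * f y)"

definition C2_on_int_dom :: "(real ^ 'd \<Rightarrow> ereal) \<Rightarrow> bool" where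
  "C2_on_int_dom f \<longleftrightarrow>
     (\<forall>x\<in>int_dom f. (\<lambda>z. real_of_ereal (f z)) differentiable (at x)) \<and>
     (\<forall>x\<in>int_dom f. grad f differentiable (at x)) \<and>
     continuous_on (int_dom f) (hessian f)"

definition pos_def :: "real ^ 'd ^ 'd \<Rightarrow> bool" where
  "pos_def M \<longleftrightarrow> transpose M = M \<and> (\<forall>h. h \<noteq> 0 \<longrightarrow> h \<bullet> (M *v h) > 0)"

section \<open>Bregman distance and projections\<close>

definition bregman :: "('a::real_inner \<Rightarrow> ereal) \<Rightarrow> 'a \<Rightarrow> 'a \<Rightarrow> ereal" where
  "bregman f x y =
     (if y \<in> int_dom f then f x - f y - ereal (grad f y \<bullet> (x - y)) else \<infinity>)"

text \<open>The minimum defining the left distance is taken over an infinite set, hence \<open>INF\<close>; it is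
  attained for nonempty compact \<open>B\<close> contained in \<open>int_dom f\<close> and \<open>a\<close> in \<open>int_dom f\<close>.\<close>

definition left_dist :: "('a::real_inner \<Rightarrow> ereal) \<Rightarrow> 'a set \<Rightarrow> 'a \<Rightarrow> ereal" where
  "left_dist f B a = (INF b\<in>B. bregman f b a)"

definition left_proj :: "('a::real_inner \<Rightarrow> ereal) \<Rightarrow> 'a set \<Rightarrow> 'a \<Rightarrow> 'a set" where
  "left_proj f B a = {b. is_arg_min (\<lambda>b'. bregman f b' a) (\<lambda>b'. b' \<in> B) b}"

definition right_proj :: "('a::real_inner \<Rightarrow> ereal) \<Rightarrow> 'a set \<Rightarrow> 'a \<Rightarrow> 'a set" where
  "right_proj f A b = {a. is_arg_min (\<lambda>a'. bregman f b a') (\<lambda>a'. a' \<in> A) a}"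

definition alternating_sequence ::
    "('a::real_inner \<Rightarrow> ereal) \<Rightarrow> 'a set \<Rightarrow> 'a set \<Rightarrow> (nat \<Rightarrow> 'a) \<Rightarrow> (nat \<Rightarrow> 'a) \<Rightarrow> bool" where
  "alternating_sequence f A B a b \<longleftrightarrow>
     (\<forall>k. a k \<in> A \<and> b k \<in> B \<and> b k \<in> left_proj f B (a k) \<and> a (Suc k) \<in> right_proj f A (b k))"

definition rl_block ::
    "('a::real_inner \<Rightarrow> ereal) \<Rightarrow> 'a set \<Rightarrow> 'a set \<Rightarrow> 'a \<Rightarrow> 'a \<Rightarrow> 'a \<Rightarrow> bool" where
  "rl_block f A B b a' b' \<longleftrightarrow> b \<in> B \<and> a' \<in> right_proj f A b \<and> b' \<in> left_proj f B a'"

section \<open>Gaps\<close>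

definition gap_pair ::
    "('a::real_inner \<Rightarrow> ereal) \<Rightarrow> 'a set \<Rightarrow> 'a set \<Rightarrow> 'a \<Rightarrow> 'a \<Rightarrow> bool" where
  "gap_pair f A B b a \<longleftrightarrow> b \<in> B \<and> a \<in> A \<and> a \<in> right_proj f A b \<and> b \<in> left_proj f B a"

definition gap_value :: "('a::real_inner \<Rightarrow> ereal) \<Rightarrow> 'a \<Rightarrow> 'a \<Rightarrow> real" where
  "gap_value f b a = (THE r. 0 \<le> r \<and> bregman f b a = ereal (r\<^sup>2 / 2))"

text \<open>Accumulation points of a sequence as limits of subsequences, not limit points of its range:
  a constant sequence accumulates at its value.\<close>

definition accumulation_points :: "(nat \<Rightarrow> 'a::topological_space) \<Rightarrow> 'a set" where
  "accumulation_points u = {x. \<exists>r::nat \<Rightarrow> nat. strict_mono r \<and> (u \<circ> r) \<longlonglongrightarrow> x}"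

definition gap_of_sequence ::
    "('a::real_inner \<Rightarrow> ereal) \<Rightarrow> 'a set \<Rightarrow> 'a set \<Rightarrow> (nat \<Rightarrow> 'a) \<Rightarrow> (nat \<Rightarrow> 'a)
      \<Rightarrow> ('a \<times> 'a) set \<Rightarrow> real \<Rightarrow> bool" where
  "gap_of_sequence f A B a b K r \<longleftrightarrow>
     0 \<le> r \<and> (\<lambda>k. bregman f (b k) (a k)) \<longlonglongrightarrow> ereal (r\<^sup>2 / 2) \<and>
     K = {(b', a'). b' \<in> accumulation_points b \<and> a' \<in> accumulation_points a \<and>
                    gap_pair f A B b' a'}"

section \<open>Angle condition and three-point inequality\<close>

text \<open>Only the values on \<open>[0, \<eta>)\<close> are relevant.\<close>

definition desingularizing :: "real \<Rightarrow> (real \<Rightarrow> real) \<Rightarrow> bool" where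
  "desingularizing \<eta> \<phi> \<longleftrightarrow>
     continuous_on {0..<\<eta>} \<phi> \<and> concave_on {0..<\<eta>} \<phi> \<and> (\<forall>s\<in>{0..<\<eta>}. 0 \<le> \<phi> s) \<and> \<phi> 0 = 0 \<and>
     (\<forall>s\<in>{0<..<\<eta>}. \<phi> differentiable (at s)) \<and> continuous_on {0<..<\<eta>} (deriv \<phi>) \<and>
     (\<forall>s\<in>{0<..<\<eta>}. deriv \<phi> s > 0)"

definition shrinking :: "real \<Rightarrow> (real \<Rightarrow> real) \<Rightarrow> real \<Rightarrow> real" where
  "shrinking r \<phi> s =
     (if r > 0 then deriv \<phi> s powi (-2) else deriv \<phi> s powi (-2) * s powi (-1))"

text \<open>For zero vectors this yields \<open>pi / 2\<close>. That case does not arise below: the angle is only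
  used for blocks with \<open>D(b, a\<^sup>+) \<ge> D(b\<^sup>+, a\<^sup>+) > 0\<close>, so \<open>b\<close> and \<open>b\<^sup>+\<close> differ from \<open>a\<^sup>+\<close>.\<close>

definition vec_angle :: "'a::real_inner \<Rightarrow> 'a \<Rightarrow> real" where
  "vec_angle u v = arccos (u \<bullet> v / (norm u * norm v))"

definition rl_angle_condition ::
    "('a::real_inner \<Rightarrow> ereal) \<Rightarrow> 'a set \<Rightarrow> 'a set \<Rightarrow> 'a \<Rightarrow> 'a \<Rightarrow> bool" where
  "rl_angle_condition f A B bs as \<longleftrightarrow>
     (let r = gap_value f bs as in
      \<exists>W \<gamma> \<eta> \<phi>. open W \<and> (bs, as) \<in> W \<and> \<gamma> > 0 \<and> \<eta> > 0 \<and> desingularizing \<eta> \<phi> \<and>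
        mono_on {0<..<\<eta>} (shrinking r \<phi>) \<and>
        (\<forall>b a' b'. rl_block f A B b a' b' \<longrightarrow> (b', a') \<in> W \<longrightarrow>
           ereal (r\<^sup>2 / 2) < bregman f b' a' \<longrightarrow> bregman f b' a' < ereal (r\<^sup>2 / 2 + \<eta>) \<longrightarrow>
           (1 - cos (vec_angle (b - a') (b' - a')))
             / shrinking r \<phi> (real_of_ereal (left_dist f B a') - r\<^sup>2 / 2) \<ge> \<gamma>))"

definition rl_three_point ::
    "('a::real_inner \<Rightarrow> ereal) \<Rightarrow> 'a set \<Rightarrow> 'a set \<Rightarrow> 'a \<Rightarrow> 'a \<Rightarrow> bool" where
  "rl_three_point f A B bs as \<longleftrightarrow>
     (\<exists>l \<delta>. 0 < l \<and> l < 1 \<and> 0 < \<delta> \<and>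
        (\<forall>b a' b'. rl_block f A B b a' b' \<longrightarrow> norm (b' - bs) < \<delta> \<longrightarrow> norm (a' - as) < \<delta> \<longrightarrow>
           bregman f b a' \<ge> bregman f b' a' + ereal l * bregman f b b'))"

end

theory Submission
  imports Defs
begin

text \<open>Put \<open>s\<^sub>k = D(b\<^sub>k, a\<^sub>k) - r\<^sup>2/2\<close> and \<open>x\<^sub>k = \<parallel>b\<^sub>k\<^sub>+\<^sub>1 - b\<^sub>k\<parallel>\<close>. By positivity and continuity of the Hessian, \<open>D\<close> is
  comparable to the squared distance on the compact convex hull of \<open>A \<union> B\<close>. Hence, near an
  accumulation point, the three-point inequality gives the descent \<open>c x\<^sub>k\<^sup>2 \<le> s\<^sub>k - s\<^sub>k\<^sub>+\<^sub>1\<close>, while the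
  cosine law turns the angle condition into \<open>e \<le> \<phi>'(s\<^sub>k\<^sub>+\<^sub>1) x\<^sub>k\<close>. With concavity of \<open>\<phi>\<close> these yield
  \<open>x\<^sub>k\<^sub>+\<^sub>1 \<le> x\<^sub>k / 2 + (\<phi>(s\<^sub>k\<^sub>+\<^sub>1) - \<phi>(s\<^sub>k\<^sub>+\<^sub>2)) / (2 e c)\<close>, whose second term telescopes, so \<open>x\<close> is summable.\<close>

section \<open>Sequences of finite length\<close>

text \<open>Contrapositive: if the sequence enters every ball around \<open>x\<close> at arbitrarily
  late indices, dependent choice selects strictly increasing indices with distances below
  \<open>1 / (n + 1)\<close>, hence a subsequence converging to \<open>x\<close>.\<close>

lemma not_accumulation_point_imp_eventually_avoids:
  fixes z :: "nat \<Rightarrow> 'a::metric_space"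
  assumes "x \<notin> accumulation_points z"
  shows "\<exists>V. open V \<and> x \<in> V \<and> (\<forall>\<^sub>F k in sequentially. z k \<notin> V)"
proof (rule ccontr)
  assume none: "\<not> ?thesis"
  have visit: "\<exists>m>n. dist (z m) x < e" if "0 < e" for e n
  proof -
    have "\<not> (\<forall>\<^sub>F k in sequentially. z k \<notin> ball x e)"
      using none that centre_in_ball open_ball by blast
    then show ?thesis
      by (auto simp: eventually_at_top_dense dist_commute)
  qed
  have "\<exists>u. \<forall>n. dist (z (u n)) x < inverse (real (Suc n)) \<and> u n < u (Suc n)"
  proof (rule dependent_nat_choice)
    show "\<exists>m. dist (z m) x < inverse (real (Suc 0))"
      using visit[of 1 0] by auto
    show "\<exists>m. dist (z m) x < inverse (real (Suc (Suc n))) \<and> k < m" for k n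
      using visit[of "inverse (real (Suc (Suc n)))" k] by auto
  qed
  then obtain u where u: "\<And>n. dist (z (u n)) x < inverse (real (Suc n))" "\<And>n. u n < u (Suc n)"
    by blast
  have "(z \<circ> u) \<longlonglongrightarrow> x"
  proof (rule metric_tendsto_imp_tendsto[OF LIMSEQ_inverse_real_of_nat])
    show "\<forall>\<^sub>F n in sequentially. dist ((z \<circ> u) n) x \<le> dist (inverse (real (Suc n))) 0"
      using u(1) by (intro always_eventually allI) (simp add: less_imp_le)
  qed
  with u(2) have "x \<in> accumulation_points z"
    by (auto simp: accumulation_points_def strict_mono_Suc_iff)
  with assms show False ..
qed

text \<open>Every point has an open neighbourhood for which finitely many indices suffice: a single
  \<open>i\<close> at an accumulation point, none elsewhere, since there the sequence eventually
  stays outside. Compactness leaves finitely many neighbourhoods, so their eventual statements hold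
  simultaneously from some index on.\<close>

lemma eventually_finite_local_property:
  fixes z :: "nat \<Rightarrow> 'a::metric_space"
  assumes "compact S" and z: "\<And>k. z k \<in> S"
    and loc: "\<And>x. x \<in> accumulation_points z \<Longrightarrow>
      \<exists>i\<in>I. \<exists>N. open N \<and> x \<in> N \<and> (\<forall>\<^sub>F k in sequentially. z k \<in> N \<longrightarrow> P i k)"
  shows "\<exists>J. finite J \<and> J \<subseteq> I \<and> (\<forall>\<^sub>F k in sequentially. \<exists>i\<in>J. P i k)"
proof -
  have "\<exists>N J. open N \<and> x \<in> N \<and> finite J \<and> J \<subseteq> I \<and>
      (\<forall>\<^sub>F k in sequentially. z k \<in> N \<longrightarrow> (\<exists>i\<in>J. P i k))" for x
  proof (cases "x \<in> accumulation_points z")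
    case True
    with loc obtain i N where iN: "i \<in> I" "open N" "x \<in> N"
      "\<forall>\<^sub>F k in sequentially. z k \<in> N \<longrightarrow> P i k"
      by blast
    then show ?thesis
      by (intro exI[of _ N] exI[of _ "{i}"]) simp
  next
    case False
    with not_accumulation_point_imp_eventually_avoids obtain V
      where V: "open V" "x \<in> V" "\<forall>\<^sub>F k in sequentially. z k \<notin> V"
      by blast
    then show ?thesis
      by (intro exI[of _ V] exI[of _ "{}"]) simp
  qed
  then have "\<forall>x. \<exists>N. open N \<and> x \<in> N \<and> (\<exists>J. finite J \<and> J \<subseteq> I \<and>
      (\<forall>\<^sub>F k in sequentially. z k \<in> N \<longrightarrow> (\<exists>i\<in>J. P i k)))"
    by simp
  from choice[OF this] obtain N where N: "\<And>x. open (N x)" "\<And>x. x \<in> N x"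
    and exJ: "\<forall>x. \<exists>J. finite J \<and> J \<subseteq> I \<and>
      (\<forall>\<^sub>F k in sequentially. z k \<in> N x \<longrightarrow> (\<exists>i\<in>J. P i k))"
    by auto
  from choice[OF exJ] obtain J where J: "\<And>x. finite (J x)" "\<And>x. J x \<subseteq> I"
    and ev: "\<And>x. \<forall>\<^sub>F k in sequentially. z k \<in> N x \<longrightarrow> (\<exists>i\<in>J x. P i k)"
    by auto
  have "S \<subseteq> (\<Union>c\<in>S. N c)"
    using N(2) by blast
  then obtain C where C: "C \<subseteq> S" "finite C" "S \<subseteq> (\<Union>c\<in>C. N c)"
    by (rule compactE_image[OF \<open>compact S\<close> N(1)])
  have "\<forall>\<^sub>F k in sequentially. \<forall>c\<in>C. z k \<in> N c \<longrightarrow> (\<exists>i\<in>J c. P i k)"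
    using C(2) ev by (simp add: eventually_ball_finite)
  then have "\<forall>\<^sub>F k in sequentially. \<exists>i\<in>\<Union> (J ` C). P i k"
  proof eventually_elim
    case (elim k)
    from z C(3) obtain c where "c \<in> C" "z k \<in> N c" by blast
    with elim show ?case by blast
  qed
  then show ?thesis
    using C(2) J by (intro exI[of _ "\<Union> (J ` C)"]) auto
qed

lemma summable_if_eventually_halving:
  fixes x w :: "nat \<Rightarrow> real"
  assumes x0: "\<And>k. 0 \<le> x k" and "summable w"
    and w0: "\<forall>\<^sub>F k in sequentially. 0 \<le> w k"
    and step: "\<forall>\<^sub>F k in sequentially. x (Suc k) \<le> x k / 2 + w k"
  shows "summable x"
proof -
  obtain n where n: "\<And>k. k \<ge> n \<Longrightarrow> 0 \<le> w k" "\<And>k. k \<ge> n \<Longrightarrow> x (Suc k) \<le> x k / 2 + w k"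
    using eventually_conj[OF w0 step] unfolding eventually_sequentially by blast
  have sw: "summable (\<lambda>k. w (k + n))"
    using \<open>summable w\<close> by (simp add: summable_iff_shift)
  \<comment> \<open>The extra term \<open>2 * x (m + n)\<close> closes the induction: one copy joins
    the partial sum, the other pays for \<open>2 * x (Suc (m + n))\<close> up to
    \<open>2 * w (m + n)\<close>.\<close>
  have bound: "(\<Sum>k<m. x (k + n)) + 2 * x (m + n) \<le> 2 * x n + 2 * (\<Sum>k<m. w (k + n))" for m
  proof (induction m)
    case (Suc m)
    with n(2)[of "m + n"] show ?case by simp
  qed simp
  have "summable (\<lambda>k. x (k + n))"
  proof (rule summableI_nonneg_bounded)
    fix m
    have "(\<Sum>k<m. w (k + n)) \<le> (\<Sum>k. w (k + n))"
      by (rule sum_le_suminf[OF sw]) (simp_all add: n(1))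
    with bound[of m] x0[of "m + n"]
    show "(\<Sum>k<m. x (k + n)) \<le> 2 * x n + 2 * (\<Sum>k. w (k + n))"
      by linarith
  qed (rule x0)
  then show ?thesis by (simp add: summable_iff_shift)
qed

lemma convergent_if_summable_steps:
  fixes b :: "nat \<Rightarrow> 'a::banach"
  assumes "summable (\<lambda>k. norm (b (Suc k) - b k))"
  shows "convergent b"
proof -
  have "(\<lambda>n. b n - b 0) \<longlonglongrightarrow> (\<Sum>k. b (Suc k) - b k)"
    using summable_LIMSEQ[OF summable_norm_cancel[OF assms]] by (simp add: sum_lessThan_telescope)
  then show ?thesis
    using tendsto_add[OF _ tendsto_const, of "\<lambda>n. b n - b 0" _ sequentially "b 0"]
    by (auto simp: convergent_def)
qed

text \<open>The convex function \<open>- \<phi>\<close> lies above its tangent at the interior point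
  \<open>s\<close>. The other point may be \<open>t = 0\<close>, where \<open>\<phi>\<close> can
  have infinite slope.\<close>

lemma concave_on_tangent_le:
  assumes "concave_on {0..<\<eta>} \<phi>" and "\<phi> differentiable (at s)"
    and "0 < s" "s < \<eta>" "0 \<le> t" "t \<le> s"
  shows "deriv \<phi> s * (s - t) \<le> \<phi> s - \<phi> t"
proof -
  have "(\<phi> has_real_derivative deriv \<phi> s) (at s)"
    using assms(2) DERIV_deriv_iff_real_differentiable by blast
  then have "((\<lambda>x. - \<phi> x) has_real_derivative - deriv \<phi> s) (at s within {0..<\<eta>})"
    by (auto intro!: derivative_eq_intros intro: has_field_derivative_at_within)
  then have "- \<phi> t - - \<phi> s \<ge> - deriv \<phi> s * (t - s)"
    by (rule convex_on_imp_above_tangent[rotated -1])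
       (use assms in \<open>auto simp: concave_on_def interior_atLeastLessThan\<close>)
  then show ?thesis by (simp add: algebra_simps)
qed

text \<open>The constants and desingularizing functions vary with the accumulation point, and consecutive
  indices may visit different neighbourhoods; summing the finitely many increments of
  \<open>\<phi> \<circ> s\<close> makes the recursion uniform.\<close>

lemma summable_steps_if_local_descent:
  fixes z :: "nat \<Rightarrow> 'a::metric_space" and s x :: "nat \<Rightarrow> real"
  assumes "compact S" and z: "\<And>k. z k \<in> S" and x0: "\<And>k. 0 \<le> x k"
    and s0: "\<And>k. 0 \<le> s k" and s_mono: "\<And>k. s (Suc k) \<le> s k" and s_lim: "s \<longlonglongrightarrow> 0"
    and descent: "\<And>p. p \<in> accumulation_points z \<Longrightarrow>
      \<exists>c>0. \<exists>N. open N \<and> p \<in> N \<and>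
        (\<forall>\<^sub>F k in sequentially. z k \<in> N \<longrightarrow> c * (x k)\<^sup>2 \<le> s k - s (Suc k))"
    and slope: "\<And>p. p \<in> accumulation_points z \<Longrightarrow>
      \<exists>e>0. \<exists>\<eta>>0. \<exists>\<phi>. desingularizing \<eta> \<phi> \<and> (\<exists>N. open N \<and> p \<in> N \<and>
        (\<forall>\<^sub>F k in sequentially. z k \<in> N \<longrightarrow> 0 < s (Suc k) \<longrightarrow> e \<le> deriv \<phi> (s (Suc k)) * x k))"
  shows "summable x"
proof -
  have "\<exists>c\<in>{0<..}. \<exists>N. open N \<and> p \<in> N \<and>
      (\<forall>\<^sub>F k in sequentially. z k \<in> N \<longrightarrow> c * (x k)\<^sup>2 \<le> s k - s (Suc k))"
    if "p \<in> accumulation_points z" for p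
    using descent[OF that] by (simp add: Bex_def)
  from eventually_finite_local_property[OF \<open>compact S\<close> z this]
  obtain C where C: "finite C" "C \<subseteq> {0<..}"
    and evC: "\<forall>\<^sub>F k in sequentially. \<exists>c\<in>C. c * (x k)\<^sup>2 \<le> s k - s (Suc k)"
    by auto
  \<comment> \<open>One descent constant for all neighbourhoods; the inserted \<open>1\<close> keeps
    the minimum meaningful when \<open>C\<close> is empty.\<close>
  define c where "c = Min (insert 1 C)"
  have c: "0 < c" "\<And>d. d \<in> C \<Longrightarrow> c \<le> d"
    using C by (auto simp: c_def)
  have ev_descent: "\<forall>\<^sub>F k in sequentially. c * (x k)\<^sup>2 \<le> s k - s (Suc k)"
    using evC
  proof eventually_elim
    case (elim k)
    then obtain d where "d \<in> C" "d * (x k)\<^sup>2 \<le> s k - s (Suc k)" by blast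
    with c(2)[of d] mult_right_mono[of c d "(x k)\<^sup>2"] show ?case by simp
  qed
  have s_Suc_lim: "(\<lambda>k. s (Suc k)) \<longlonglongrightarrow> 0"
    using s_lim by (rule LIMSEQ_Suc)
  \<comment> \<open>Admissible error terms serve as the index set of the compactness argument; this
    class is closed under finite sums.\<close>
  define I where "I = {w :: nat \<Rightarrow> real. summable w \<and> (\<forall>\<^sub>F k in sequentially. 0 \<le> w k)}"
  have loc: "\<exists>w\<in>I. \<exists>N. open N \<and> p \<in> N \<and>
      (\<forall>\<^sub>F k in sequentially. z k \<in> N \<longrightarrow> x (Suc k) \<le> x k / 2 + w k)"
    if p: "p \<in> accumulation_points z" for p
  proof -
    obtain e \<eta> \<phi> N where e: "0 < e" and \<eta>: "0 < \<eta>" and \<phi>: "desingularizing \<eta> \<phi>"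
      and N: "open N" "p \<in> N"
      and ev: "\<forall>\<^sub>F k in sequentially.
        z k \<in> N \<longrightarrow> 0 < s (Suc k) \<longrightarrow> e \<le> deriv \<phi> (s (Suc k)) * x k"
      using slope[OF p] by blast
    have less: "\<forall>\<^sub>F k in sequentially. s (Suc k) < \<eta>"
      using s_Suc_lim \<eta> by (rule order_tendstoD)
    \<comment> \<open>A multiple of the increment of \<open>\<phi> \<circ> s\<close>; the factor
      \<open>2 * (e * c)\<close> is the one left by the arithmetic-geometric mean inequality
      below.\<close>
    define w where "w k = (\<phi> (s (Suc k)) - \<phi> (s (Suc (Suc k)))) / (2 * (e * c))" for k
    have tangent: "\<forall>\<^sub>F k in sequentially. 0 < s (Suc k) \<longrightarrow>
      0 < deriv \<phi> (s (Suc k)) \<and>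
      deriv \<phi> (s (Suc k)) * (s (Suc k) - s (Suc (Suc k))) \<le> \<phi> (s (Suc k)) - \<phi> (s (Suc (Suc k)))"
      using less
    proof eventually_elim
      case (elim k)
      with \<phi> s0[of "Suc (Suc k)"] s_mono[of "Suc k"] show ?case
        unfolding desingularizing_def by (auto intro!: concave_on_tangent_le)
    qed
    \<comment> \<open>The slope bound speaks only of positive \<open>s (Suc k)\<close>. Otherwise
      \<open>s\<close> vanishes from that index on, and descent forces
      \<open>x (Suc k) = 0\<close>.\<close>
    have zero: "s (Suc (Suc k)) = 0" if "\<not> 0 < s (Suc k)" for k
      using that s_mono[of "Suc k"] s0[of "Suc (Suc k)"] by linarith
    have zero': "s (Suc k) = 0" if "\<not> 0 < s (Suc k)" for k
      using that s0[of "Suc k"] by linarith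
    \<comment> \<open>Continuity at \<open>0\<close> makes \<open>\<phi> \<circ> s\<close>
      convergent, so its increments form a convergent telescoping series.\<close>
    have "continuous_on {0..<\<eta>} \<phi>"
      using \<phi> by (simp add: desingularizing_def)
    then have "(\<lambda>k. \<phi> (s (Suc k))) \<longlonglongrightarrow> \<phi> 0"
      by (rule continuous_on_tendsto_compose[OF _ s_Suc_lim]) (use less s0 \<eta> in auto)
    then have "summable w"
      unfolding w_def by (intro summable_divide telescope_summable')
    moreover have "\<forall>\<^sub>F k in sequentially. 0 \<le> w k"
      using tangent
    proof eventually_elim
      case (elim k)
      show ?case
      proof (cases "0 < s (Suc k)")
        case True
        with elim s_mono[of "Suc k"]
        have "0 \<le> deriv \<phi> (s (Suc k)) * (s (Suc k) - s (Suc (Suc k)))" by simp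
        with elim True have "0 \<le> \<phi> (s (Suc k)) - \<phi> (s (Suc (Suc k)))" by linarith
        with e c(1) show ?thesis by (simp add: w_def)
      qed (simp add: w_def zero zero')
    qed
    \<comment> \<open>Slope is taken at index \<open>k\<close> and descent at \<open>Suc k\<close>,
      so that both refer to the value \<open>s (Suc k)\<close>.\<close>
    moreover have "\<forall>\<^sub>F k in sequentially. z k \<in> N \<longrightarrow> x (Suc k) \<le> x k / 2 + w k"
      using ev tangent eventually_sequentially_Suc[THEN iffD2, OF ev_descent]
    proof eventually_elim
      case (elim k)
      show ?case
      proof (intro impI, cases "0 < s (Suc k)")
        case False
        with elim(3) zero[of k] zero'[of k] zero[of "Suc k"] zero'[of "Suc k"]
        have "c * (x (Suc k))\<^sup>2 \<le> 0" by simp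
        with c(1) have "x (Suc k) = 0" by (simp add: mult_le_0_iff)
        with False x0[of k] show "x (Suc k) \<le> x k / 2 + w k"
          by (simp add: w_def zero zero')
      next
        case True
        define g where "g = deriv \<phi> (s (Suc k))"
        define D where "D = \<phi> (s (Suc k)) - \<phi> (s (Suc (Suc k)))"
        assume "z k \<in> N"
        with elim True have g: "0 < g" "e \<le> g * x k"
          and D: "g * (s (Suc k) - s (Suc (Suc k))) \<le> D"
          by (simp_all add: g_def D_def)
        have xk: "0 \<le> x k" by (rule x0)
        have amgm: "u * v \<le> ((u + v) / 2)\<^sup>2" for u v :: real
          using zero_le_power2[of "u - v"] by (simp add: power2_eq_square field_simps)
        \<comment> \<open>Slope, descent and the tangent inequality bound \<open>x (Suc k)\<close>
          by the geometric mean of \<open>x k\<close> and \<open>D / (e * c)\<close>; passing to the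
          arithmetic mean produces the factor one half.\<close>
        have "e * (c * (x (Suc k))\<^sup>2) \<le> (g * x k) * (c * (x (Suc k))\<^sup>2)"
          using g c by (intro mult_right_mono) auto
        also have "\<dots> = x k * (g * (c * (x (Suc k))\<^sup>2))" by simp
        also have "\<dots> \<le> x k * (g * (s (Suc k) - s (Suc (Suc k))))"
          using g elim(3) xk by (intro mult_left_mono) auto
        also have "\<dots> \<le> x k * D"
          using D xk by (rule mult_left_mono)
        finally have "(x (Suc k))\<^sup>2 \<le> x k * (D / (e * c))"
          using e c(1) by (simp add: field_simps)
        also have "\<dots> \<le> ((x k + D / (e * c)) / 2)\<^sup>2"
          by (rule amgm)
        finally have square: "(x (Suc k))\<^sup>2 \<le> ((x k + D / (e * c)) / 2)\<^sup>2" .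
        have "0 \<le> g * (s (Suc k) - s (Suc (Suc k)))"
          using g s_mono[of "Suc k"] by simp
        with D e c(1) have "0 \<le> D / (e * c)" by simp
        with xk have "x (Suc k) \<le> (x k + D / (e * c)) / 2"
          by (intro power2_le_imp_le[OF square]) simp
        also have "\<dots> = x k / 2 + w k"
          by (simp add: w_def D_def add_divide_distrib mult.commute)
        finally show "x (Suc k) \<le> x k / 2 + w k" .
      qed
    qed
    ultimately show ?thesis
      using N unfolding I_def by blast
  qed
  from eventually_finite_local_property[OF \<open>compact S\<close> z loc]
  obtain J where J: "finite J" "J \<subseteq> I"
    and evJ: "\<forall>\<^sub>F k in sequentially. \<exists>w\<in>J. x (Suc k) \<le> x k / 2 + w k"
    by auto
  \<comment> \<open>Which \<open>w\<close> works may change with \<open>k\<close>; since all are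
    eventually nonnegative, their sum dominates each of them.\<close>
  have nonneg: "\<forall>\<^sub>F k in sequentially. \<forall>w\<in>J. 0 \<le> w k"
    using J by (intro eventually_ball_finite) (auto simp: I_def)
  show ?thesis
  proof (rule summable_if_eventually_halving[OF x0])
    show "summable (\<lambda>k. \<Sum>w\<in>J. w k)"
      using J by (intro summable_sum) (auto simp: I_def)
    show "\<forall>\<^sub>F k in sequentially. 0 \<le> (\<Sum>w\<in>J. w k)"
      using nonneg by eventually_elim (simp add: sum_nonneg)
    show "\<forall>\<^sub>F k in sequentially. x (Suc k) \<le> x k / 2 + (\<Sum>w\<in>J. w k)"
      using nonneg evJ
    proof eventually_elim
      case (elim k)
      then obtain w where w: "w \<in> J" "x (Suc k) \<le> x k / 2 + w k" by blast
      have "w k \<le> (\<Sum>w\<in>J. w k)"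
        using elim(1) w(1) J(1) by (intro member_le_sum) auto
      with w(2) show ?case by linarith
    qed
  qed
qed

section \<open>Quadratic comparison of the Bregman distance\<close>

text \<open>Real-valued form in which the estimates are carried out. It agrees with
  \<open>bregman\<close> when both points lie in the interior of the domain, but does not take the
  value infinity elsewhere.\<close>

definition real_bregman :: "('a::real_inner \<Rightarrow> ereal) \<Rightarrow> 'a \<Rightarrow> 'a \<Rightarrow> real" where
  "real_bregman f x y = real_of_ereal (f x) - real_of_ereal (f y) - grad f y \<bullet> (x - y)"

lemma real_bregman_same [simp]: "real_bregman f x x = 0"
  by (simp add: real_bregman_def)

lemma bregman_eq_real_bregman:
  assumes "proper_convex f" and "x \<in> int_dom f" and "y \<in> int_dom f"
  shows "bregman f x y = ereal (real_bregman f x y)"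
proof -
  have "\<bar>f z\<bar> \<noteq> \<infinity>" if "z \<in> int_dom f" for z
    using assms(1) subsetD[OF interior_subset that] by (auto simp: proper_convex_def dom_def)
  then obtain u v where "f x = ereal u" "f y = ereal v"
    using assms(2,3) by (metis ereal_real')
  with assms(3) show ?thesis
    by (simp add: bregman_def real_bregman_def)
qed

text \<open>The domain is the projection of the convex epigraph: both points are lifted to finite
  heights, combined there and projected back.\<close>

lemma convex_dom:
  assumes "proper_convex f"
  shows "convex (dom f)"
proof (rule convexI)
  fix x y and u v :: real
  assume x: "x \<in> dom f" and y: "y \<in> dom f" and uv: "0 \<le> u" "0 \<le> v" "u + v = 1"
  have fin: "\<exists>\<mu>. f z \<le> ereal \<mu>" if "z \<in> dom f" for z
    using that by (cases "f z") (auto simp: dom_def)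
  from fin[OF x] fin[OF y] obtain \<mu> \<nu> where "f x \<le> ereal \<mu>" "f y \<le> ereal \<nu>"
    by blast
  with assms uv have "u *\<^sub>R (x, \<mu>) + v *\<^sub>R (y, \<nu>) \<in> {(x, \<mu>::real). f x \<le> ereal \<mu>}"
    unfolding proper_convex_def by (intro convexD) auto
  then have "f (u *\<^sub>R x + v *\<^sub>R y) \<le> ereal (u * \<mu> + v * \<nu>)"
    by simp
  then show "u *\<^sub>R x + v *\<^sub>R y \<in> dom f"
    unfolding dom_def by (auto intro: le_less_trans)
qed

text \<open>Justifies the definite description in \<open>grad\<close>. The adjoint of the
  derivative, applied to \<open>1\<close>, is its Riesz representative; testing two representatives
  on their difference shows that they coincide.\<close>

lemma has_derivative_grad:
  fixes f :: "'a::euclidean_space \<Rightarrow> ereal"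
  assumes "(\<lambda>z. real_of_ereal (f z)) differentiable (at x)"
  shows "((\<lambda>z. real_of_ereal (f z)) has_derivative (\<lambda>h. h \<bullet> grad f x)) (at x)"
proof -
  obtain F' where F': "((\<lambda>z. real_of_ereal (f z)) has_derivative F') (at x)"
    using assms by (auto simp: differentiable_def)
  have "F' h = h \<bullet> adjoint F' 1" for h
    using adjoint_works[OF has_derivative_linear[OF F'], of h 1] by simp
  with F' have ex: "GDERIV (\<lambda>z. real_of_ereal (f z)) x :> adjoint F' 1"
    unfolding gderiv_def by (metis ext)
  have uniq: "g = adjoint F' 1" if "GDERIV (\<lambda>z. real_of_ereal (f z)) x :> g" for g
  proof -
    have "(\<lambda>h. h \<bullet> g) = (\<lambda>h. h \<bullet> adjoint F' 1)"
      using has_derivative_unique that ex unfolding gderiv_def by blast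
    then have "(g - adjoint F' 1) \<bullet> g = (g - adjoint F' 1) \<bullet> adjoint F' 1"
      by (rule fun_cong)
    then have "(g - adjoint F' 1) \<bullet> (g - adjoint F' 1) = 0"
      by (simp add: inner_diff_right)
    then show ?thesis by simp
  qed
  have "grad f x = adjoint F' 1"
    unfolding grad_def using ex uniq by (rule the_equality)
  with ex show ?thesis by (simp add: gderiv_def)
qed

lemma has_derivative_grad_hessian:
  assumes "grad f differentiable (at x)"
  shows "(grad f has_derivative (\<lambda>h. hessian f x *v h)) (at x)"
proof -
  have "(grad f has_derivative frechet_derivative (grad f) (at x)) (at x)"
    using assms by (simp add: frechet_derivative_works)
  moreover from this have "(\<lambda>h. hessian f x *v h) = frechet_derivative (grad f) (at x)"
    unfolding hessian_def by (intro matrix_vector_mul) (rule has_derivative_linear)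
  ultimately show ?thesis by simp
qed

lemma continuous_on_real_bregman:
  fixes f :: "real ^ 'd \<Rightarrow> ereal"
  assumes "C2_on_int_dom f"
  shows "continuous_on (int_dom f \<times> int_dom f) (\<lambda>(x, y). real_bregman f x y)"
proof -
  have F: "continuous_on (int_dom f) (\<lambda>z. real_of_ereal (f z))"
    and g: "continuous_on (int_dom f) (grad f)"
    using assms unfolding C2_on_int_dom_def
    by (auto intro!: continuous_at_imp_continuous_on differentiable_imp_continuous_within)
  note comp = continuous_on_compose2[OF F] continuous_on_compose2[OF g]
  show ?thesis
    unfolding real_bregman_def case_prod_beta
    by (intro continuous_intros comp) auto
qed

text \<open>The Bregman distance is the first-order Taylor remainder of \<open>f\<close> at
  \<open>y\<close>. The Lagrange form on the segment from \<open>y\<close> to \<open>x\<close> gives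
  \<open>\<xi>\<close>, which lies in \<open>C\<close> by convexity.\<close>

lemma real_bregman_eq_hessian:
  fixes f :: "real ^ 'd \<Rightarrow> ereal"
  assumes "C2_on_int_dom f" and "C \<subseteq> int_dom f" and "convex C" and xy: "x \<in> C" "y \<in> C"
  obtains \<xi> where "\<xi> \<in> C" and "real_bregman f x y = ((x - y) \<bullet> (hessian f \<xi> *v (x - y))) / 2"
proof -
  define v where "v = x - y"
  define p where "p t = y + t *\<^sub>R v" for t :: real
  \<comment> \<open>For \<open>m = 0, 1, 2\<close> this is the \<open>m\<close>-th derivative of
    \<open>f\<close> along the segment.\<close>
  define q :: "nat \<Rightarrow> real \<Rightarrow> real" where
    "q m t = (if m = 0 then real_of_ereal (f (p t))
      else if m = 1 then v \<bullet> grad f (p t) else v \<bullet> (hessian f (p t) *v v))" for m t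
  have pC: "p t \<in> C" if "0 \<le> t" "t \<le> 1" for t
  proof -
    have "(1 - t) *\<^sub>R y + t *\<^sub>R x \<in> C"
      using that assms by (intro convexD) auto
    then show ?thesis by (simp add: p_def v_def algebra_simps)
  qed
  have dp: "(p has_derivative (\<lambda>h. h *\<^sub>R v)) (at t)" for t
    unfolding p_def by (auto intro!: derivative_eq_intros)
  have dq: "DERIV (q m) t :> q (Suc m) t" if "m < 2" "0 \<le> t" "t \<le> 1" for m t
  proof -
    from pC that have pt: "p t \<in> int_dom f" using assms(2) by blast
    have d0: "((\<lambda>z. real_of_ereal (f z)) has_derivative (\<lambda>h. h \<bullet> grad f (p t))) (at (p t))"
      using assms(1) pt by (intro has_derivative_grad) (simp add: C2_on_int_dom_def)
    have d1: "(grad f has_derivative (\<lambda>h. hessian f (p t) *v h)) (at (p t))"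
      using assms(1) pt by (intro has_derivative_grad_hessian) (simp add: C2_on_int_dom_def)
    from that(1) consider "m = 0" | "m = 1" by fastforce
    then show ?thesis
    proof cases
      case 1
      have "((\<lambda>t. real_of_ereal (f (p t))) has_derivative (\<lambda>h. (h *\<^sub>R v) \<bullet> grad f (p t))) (at t)"
        using has_derivative_compose[OF dp d0] .
      with 1 show ?thesis
        by (simp add: q_def[abs_def] has_field_derivative_def mult_commute_abs)
    next
      case 2
      have "((\<lambda>t. v \<bullet> grad f (p t)) has_derivative (\<lambda>h. v \<bullet> (hessian f (p t) *v (h *\<^sub>R v)))) (at t)"
        by (intro has_derivative_inner_right has_derivative_compose[OF dp d1])
      with 2 show ?thesis
        by (simp add: q_def[abs_def] has_field_derivative_def matrix_vector_mult_scaleR mult_commute_abs)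
    qed
  qed
  have "\<exists>t. 0 < t \<and> t < 1 \<and> q 0 1 = (\<Sum>m<2. q m 0 / fact m * (1 - 0) ^ m) + q 2 t / fact 2 * (1 - 0)\<^sup>2"
    by (rule Taylor_up[where a = 0]) (use dq in auto)
  then obtain t where t: "0 < t" "t < 1" and taylor: "q 0 1 = q 0 0 + q 1 0 + q 2 t / 2"
    by (auto simp: numeral_2_eq_2)
  have "real_bregman f x y = (v \<bullet> (hessian f (p t) *v v)) / 2"
    using taylor by (simp add: q_def p_def v_def real_bregman_def inner_commute)
  with t pC[of t] that[of "p t"] show thesis
    by (simp add: v_def)
qed

text \<open>On the compact product of \<open>C\<close> with the unit sphere the Hessian form attains
  a positive minimum and a maximum. Halves of these serve as \<open>m\<close> and \<open>M\<close>,
  by the Taylor identity and homogeneity of degree two.\<close>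

lemma real_bregman_quadratic_bounds:
  fixes f :: "real ^ 'd \<Rightarrow> ereal"
  assumes C2: "C2_on_int_dom f" and pd: "\<And>x. x \<in> int_dom f \<Longrightarrow> pos_def (hessian f x)"
    and C: "C \<subseteq> int_dom f" "convex C" "compact C"
  obtains m M where "0 < m" and "0 < M"
    and "\<And>x y. x \<in> C \<Longrightarrow> y \<in> C \<Longrightarrow> m * (norm (x - y))\<^sup>2 \<le> real_bregman f x y"
    and "\<And>x y. x \<in> C \<Longrightarrow> y \<in> C \<Longrightarrow> real_bregman f x y \<le> M * (norm (x - y))\<^sup>2"
proof (cases "C = {}")
  case True
  then show thesis using that[of 1 1] by simp
next
  case False
  define Q where "Q = (\<lambda>(x, u). u \<bullet> (hessian f x *v u))"
  let ?S = "C \<times> sphere 0 1 :: ((real ^ 'd) \<times> (real ^ 'd)) set"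
  have "axis undefined 1 \<in> (sphere 0 1 :: (real ^ 'd) set)" by (simp add: norm_axis_1)
  with False have S: "compact ?S" "?S \<noteq> {}"
    using C(3) by (auto intro: compact_Times simp del: mem_sphere_0)
  have H: "continuous_on C (hessian f)"
    using C2 C(1) by (auto simp: C2_on_int_dom_def intro: continuous_on_subset)
  have "continuous_on ?S Q"
    unfolding Q_def case_prod_beta matrix_vector_mult_def
    by (intro continuous_intros continuous_on_compose2[OF H]) auto
  from continuous_attains_inf[OF S this] continuous_attains_sup[OF S this]
  obtain z0 z1 where z0: "z0 \<in> ?S" "\<And>z. z \<in> ?S \<Longrightarrow> Q z0 \<le> Q z"
    and z1: "z1 \<in> ?S" "\<And>z. z \<in> ?S \<Longrightarrow> Q z \<le> Q z1"
    by blast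
  have pos: "0 < Q z" if "z \<in> ?S" for z
  proof -
    obtain x u where z: "z = (x, u)" by (cases z)
    with that have "x \<in> int_dom f" "u \<noteq> 0" using C(1) by auto
    with pd[of x] show ?thesis by (simp add: z Q_def pos_def_def)
  qed
  have bounds: "Q z0 / 2 * (norm (x - y))\<^sup>2 \<le> real_bregman f x y \<and>
      real_bregman f x y \<le> Q z1 / 2 * (norm (x - y))\<^sup>2" if xy: "x \<in> C" "y \<in> C" for x y
  proof (cases "x = y")
    case False
    define n where "n = norm (x - y)"
    define u where "u = (x - y) /\<^sub>R n"
    have n: "0 < n" "x - y = n *\<^sub>R u" using False by (simp_all add: n_def u_def)
    obtain \<xi> where \<xi>: "\<xi> \<in> C" and eq: "real_bregman f x y = ((x - y) \<bullet> (hessian f \<xi> *v (x - y))) / 2"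
      using real_bregman_eq_hessian[OF C2 C(1,2) xy] .
    have eq': "real_bregman f x y = Q (\<xi>, u) / 2 * n\<^sup>2"
      unfolding eq n(2) by (simp add: Q_def matrix_vector_mult_scaleR power2_eq_square)
    have "norm u = 1" using n(1) by (simp add: u_def n_def)
    with \<xi> have mem: "(\<xi>, u) \<in> ?S" by simp
    from z0(2)[OF mem] z1(2)[OF mem] show ?thesis
      unfolding eq' n_def[symmetric] by (intro conjI mult_right_mono) auto
  qed simp
  show thesis
    by (rule that[of "Q z0 / 2" "Q z1 / 2"]) (use pos z0(1) z1(1) bounds in auto)
qed

text \<open>Cauchy-Schwarz places the quotient in the range where \<open>arccos\<close> is inverted
  by \<open>cos\<close>. For a zero vector both sides vanish whatever the angle.\<close>

lemma norm_mult_cos_vec_angle: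
  fixes u v :: "'a::real_inner"
  shows "norm u * norm v * cos (vec_angle u v) = u \<bullet> v"
proof -
  have "\<bar>u \<bullet> v / (norm u * norm v)\<bar> \<le> 1"
    using Cauchy_Schwarz_ineq2[of u v] by (simp add: divide_le_eq abs_mult)
  then have "cos (vec_angle u v) = u \<bullet> v / (norm u * norm v)"
    unfolding vec_angle_def by (intro cos_arccos) linarith+
  then show ?thesis by (cases "u = 0 \<or> v = 0") auto
qed

text \<open>The law of cosines combined with \<open>2 * norm u * norm v \<le> (norm u)\<^sup>2 +
  (norm v)\<^sup>2\<close>.\<close>

lemma norm_diff_ge_vec_angle:
  fixes u v :: "'a::real_inner"
  shows "2 * norm u * norm v * (1 - cos (vec_angle u v)) \<le> (norm (u - v))\<^sup>2"
proof -
  have "(norm (u - v))\<^sup>2 = (norm u)\<^sup>2 + (norm v)\<^sup>2 - 2 * (u \<bullet> v)"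
    by (simp add: power2_norm_eq_inner inner_diff inner_commute)
  with sum_squares_bound[of "norm u" "norm v"] show ?thesis
    by (simp add: norm_mult_cos_vec_angle[symmetric, of u v] algebra_simps)
qed

section \<open>Bregman alternating sequences\<close>

lemma gap_value_eqI:
  assumes "0 \<le> r" and "bregman f b a = ereal (r\<^sup>2 / 2)"
  shows "gap_value f b a = r"
  unfolding gap_value_def
proof (rule the_equality)
  show "0 \<le> r \<and> bregman f b a = ereal (r\<^sup>2 / 2)" using assms by blast
  show "r' = r" if "0 \<le> r' \<and> bregman f b a = ereal (r'\<^sup>2 / 2)" for r'
    using that assms by (auto intro: power2_eq_imp_eq)
qed

lemma left_dist_eq_if_left_proj:
  assumes "b \<in> left_proj f B a"
  shows "left_dist f B a = bregman f b a"
  unfolding left_dist_def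
  using assms by (intro antisym INF_lower INF_greatest) (auto simp: left_proj_def is_arg_min_linorder)

theorem theorem7p1:
  fixes f :: "real ^ 'd \<Rightarrow> ereal"
    and A B :: "(real ^ 'd) set"
    and a b :: "nat \<Rightarrow> real ^ 'd"
    and K :: "((real ^ 'd) \<times> (real ^ 'd)) set"
    and r :: real
  assumes "legendre_type f"
    and "C2_on_int_dom f"
    and "\<And>x. x \<in> int_dom f \<Longrightarrow> pos_def (hessian f x)"
    and "A \<noteq> {}" and "closed A" and "bounded A" and "A \<subseteq> int_dom f"
    and "B \<noteq> {}" and "closed B" and "bounded B" and "B \<subseteq> int_dom f"
    and "alternating_sequence f A B a b"
    and "gap_of_sequence f A B a b K r"
    and "\<And>bs as. (bs, as) \<in> K \<Longrightarrow> rl_angle_condition f A B bs as"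
    and "\<And>bs as. (bs, as) \<in> K \<Longrightarrow> rl_three_point f A B bs as"
  shows "(\<forall>k\<ge>1. b k \<in> (\<Union>a'\<in>right_proj f A (b (k - 1)). left_proj f B a')) \<and> convergent b"
proof
  have aA: "a k \<in> A" and bB: "b k \<in> B" and bP: "b k \<in> left_proj f B (a k)"
    and aP: "a (Suc k) \<in> right_proj f A (b k)" for k
    using assms(12) by (simp_all add: alternating_sequence_def)
  show "\<forall>k\<ge>1. b k \<in> (\<Union>a'\<in>right_proj f A (b (k - 1)). left_proj f B a')"
  proof (intro allI impI)
    fix k :: nat
    assume "1 \<le> k"
    then show "b k \<in> (\<Union>a'\<in>right_proj f A (b (k - 1)). left_proj f B a')"
      using aP[of "k - 1"] bP[of k] by auto
  qed

  \<comment> \<open>Quadratic bounds for the Bregman distance near \<open>A\<close> and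
    \<open>B\<close>\<close>
  define d where "d = real_bregman f"
  have pc: "proper_convex f"
    using assms(1) by (simp add: legendre_type_def)
  have D: "bregman f x y = ereal (d x y)" if "x \<in> int_dom f" "y \<in> int_dom f" for x y
    unfolding d_def using bregman_eq_real_bregman[OF pc that] .
  have AG: "x \<in> int_dom f" if "x \<in> A" for x using assms(7) that by blast
  have BG: "x \<in> int_dom f" if "x \<in> B" for x using assms(11) that by blast
  note G = AG BG aA bB
  have compact: "compact A" "compact B" "compact (B \<times> A)"
    using assms(5,6,9,10) by (simp_all add: compact_eq_bounded_closed compact_Times bounded_Times closed_Times)
  \<comment> \<open>The Taylor expansion runs along segments, so \<open>A\<close> and
    \<open>B\<close> are enclosed in a compact convex set; the interior of the domain, being convex,
    contains it.\<close>
  define C where "C = convex hull (A \<union> B)"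
  have C: "C \<subseteq> int_dom f" "convex C" "compact C"
    using convex_interior[OF convex_dom[OF pc]] assms(7,11) compact
    by (simp_all add: C_def hull_minimal compact_convex_hull compact_Un)
  have AC: "x \<in> C" if "x \<in> A \<union> B" for x
    unfolding C_def using that by (rule hull_inc)
  obtain m M where m: "0 < m" and M: "0 < M"
    and lower: "\<And>x y. x \<in> C \<Longrightarrow> y \<in> C \<Longrightarrow> m * (norm (x - y))\<^sup>2 \<le> d x y"
    and upper: "\<And>x y. x \<in> C \<Longrightarrow> y \<in> C \<Longrightarrow> d x y \<le> M * (norm (x - y))\<^sup>2"
    unfolding d_def using real_bregman_quadratic_bounds[OF assms(2,3) C] by blast
  have d_lim: "((\<lambda>n. d (x n) (y n)) \<longlongrightarrow> d p q) F"
    if "(x \<longlongrightarrow> p) F" "(y \<longlongrightarrow> q) F" "p \<in> int_dom f" "q \<in> int_dom f" for x y p q and F :: "nat filter"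
  proof -
    have "isCont (\<lambda>(x, y). d x y) (p, q)"
      using continuous_on_real_bregman[OF assms(2)] that(3,4) unfolding d_def
      by (simp add: continuous_on_eq_continuous_at open_Times)
    from isCont_tendsto_compose[OF this tendsto_Pair[OF that(1,2)]] show ?thesis
      by simp
  qed

  \<comment> \<open>Monotone distances along the sequence\<close>
  have lmin: "d (b k) (a k) \<le> d x (a k)" if "x \<in> B" for x k
    using bP[of k] that by (simp add: left_proj_def is_arg_min_linorder D G)
  have rmin: "d (b k) (a (Suc k)) \<le> d (b k) x" if "x \<in> A" for x k
    using aP[of k] that by (simp add: right_proj_def is_arg_min_linorder D G)
  have block: "rl_block f A B (b k) (a (Suc k)) (b (Suc k))" for k
    using aP bP bB by (simp add: rl_block_def)
  have r0: "0 \<le> r" and K: "K = {(b', a'). b' \<in> accumulation_points b \<and>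
      a' \<in> accumulation_points a \<and> gap_pair f A B b' a'}"
    and "(\<lambda>k. bregman f (b k) (a k)) \<longlonglongrightarrow> ereal (r\<^sup>2 / 2)"
    using assms(13) by (simp_all add: gap_of_sequence_def)
  then have gap_lim: "(\<lambda>k. d (b k) (a k)) \<longlonglongrightarrow> r\<^sup>2 / 2"
    by (simp add: D G)
  \<comment> \<open>The two projections squeeze this distance between those of consecutive
    pairs.\<close>
  have half_gap_lim: "(\<lambda>k. d (b k) (a (Suc k))) \<longlonglongrightarrow> r\<^sup>2 / 2"
    by (rule tendsto_sandwich[OF _ _ LIMSEQ_Suc[OF gap_lim] gap_lim])
       (simp_all add: lmin rmin aA bB)
  define s where "s k = d (b k) (a k) - r\<^sup>2 / 2" for k
  have s_lim: "s \<longlonglongrightarrow> 0"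
    unfolding s_def using tendsto_diff[OF gap_lim tendsto_const[of "r\<^sup>2 / 2"]] by simp
  have s_mono: "s (Suc k) \<le> s k" for k
    using lmin[OF bB, of "Suc k" k] rmin[OF aA, of k k] by (simp add: s_def)
  have s0: "0 \<le> s k" for k
    using decseq_ge[OF _ s_lim] s_mono by (simp add: decseq_Suc_iff)
  \<comment> \<open>The shift makes \<open>z k\<close> the pair of end points of the building block
    that starts at \<open>b k\<close>, which is what the local conditions restrict.\<close>
  define z where "z k = (b (Suc k), a (Suc k))" for k
  define x where "x k = norm (b (Suc k) - b k)" for k

  \<comment> \<open>Accumulation points of the pairs are gap pairs with value
    \<open>r\<close>\<close>
  have acc: "p \<in> K" "gap_value f (fst p) (snd p) = r" if p: "p \<in> accumulation_points z" for p
  proof -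
    obtain bs as where bsas: "p = (bs, as)" by (cases p)
    from p obtain u where u: "strict_mono u" and zu: "(z \<circ> u) \<longlonglongrightarrow> (bs, as)"
      unfolding accumulation_points_def bsas by blast
    define v where "v = Suc \<circ> u"
    have v: "strict_mono v"
      using u by (simp add: v_def strict_mono_def)
    have bv: "(b \<circ> v) \<longlonglongrightarrow> bs" and av: "(a \<circ> v) \<longlonglongrightarrow> as"
      using tendsto_fst[OF zu] tendsto_snd[OF zu] by (simp_all add: z_def v_def o_def)
    have bs: "bs \<in> B" and as: "as \<in> A"
      using closed_sequentially[OF assms(9) _ bv] closed_sequentially[OF assms(5) _ av] aA bB by auto
    have "(\<lambda>n. d (b (v n)) (a (v n))) \<longlonglongrightarrow> d bs as"
      using d_lim[OF bv av] bs as G by simp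
    moreover have vals: "(\<lambda>n. d (b (v n)) (a (v n))) \<longlonglongrightarrow> r\<^sup>2 / 2"
      using LIMSEQ_subseq_LIMSEQ[OF gap_lim v] by (simp add: o_def)
    ultimately have val: "d bs as = r\<^sup>2 / 2"
      by (rule LIMSEQ_unique)
    \<comment> \<open>The points \<open>a (Suc (v n))\<close> may fail to converge, but their
      distances to \<open>b (v n)\<close> tend to \<open>r\<^sup>2 / 2\<close>, which is
      \<open>d bs as\<close>.\<close>
    have "d bs as \<le> d bs y" if y: "y \<in> A" for y
    proof (rule LIMSEQ_le)
      show "(\<lambda>n. d (b (v n)) (a (Suc (v n)))) \<longlonglongrightarrow> d bs as"
        using LIMSEQ_subseq_LIMSEQ[OF half_gap_lim v] by (simp add: o_def val)
      show "(\<lambda>n. d (b (v n)) y) \<longlonglongrightarrow> d bs y"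
        using d_lim[OF bv tendsto_const] bs y G by simp
    qed (use rmin y in blast)
    moreover have "d bs as \<le> d y as" if y: "y \<in> B" for y
    proof (rule LIMSEQ_le)
      show "(\<lambda>n. d (b (v n)) (a (v n))) \<longlonglongrightarrow> d bs as"
        using vals by (simp add: val)
      show "(\<lambda>n. d y (a (v n))) \<longlonglongrightarrow> d y as"
        using d_lim[OF tendsto_const av] as y G by simp
    qed (use lmin y in blast)
    ultimately have "gap_pair f A B bs as"
      using bs as by (simp add: gap_pair_def left_proj_def right_proj_def is_arg_min_linorder D G)
    with v bv av show "p \<in> K"
      unfolding K bsas accumulation_points_def by blast
    show "gap_value f (fst p) (snd p) = r"
      using r0 val bs as by (intro gap_value_eqI) (simp_all add: bsas D G)
  qed

  \<comment> \<open>Finite length from local descent and slope\<close>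
  have "summable x"
  proof (rule summable_steps_if_local_descent[OF compact(3) _ _ s0 s_mono s_lim])
    show "z k \<in> B \<times> A" and "0 \<le> x k" for k
      by (simp_all add: z_def x_def aA bB)
  next
    fix p assume p: "p \<in> accumulation_points z"
    obtain bs as where bsas: "p = (bs, as)" by (cases p)
    obtain l \<delta> where l: "0 < l" and \<delta>: "0 < \<delta>"
      and tp: "\<And>b a' b'. rl_block f A B b a' b' \<Longrightarrow> norm (b' - bs) < \<delta> \<Longrightarrow> norm (a' - as) < \<delta> \<Longrightarrow>
        bregman f b' a' + ereal l * bregman f b b' \<le> bregman f b a'"
      using assms(15)[of bs as] acc(1)[OF p] unfolding rl_three_point_def bsas by blast
    \<comment> \<open>The three-point inequality controls \<open>d (b k) (b (Suc k))\<close>, which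
      is at least \<open>m * (x k)\<^sup>2\<close>; the right projection then replaces
      \<open>a (Suc k)\<close> by \<open>a k\<close>.\<close>
    have "l * m * (x k)\<^sup>2 \<le> s k - s (Suc k)" if zk: "z k \<in> ball bs \<delta> \<times> ball as \<delta>" for k
    proof -
      have "d (b (Suc k)) (a (Suc k)) + l * d (b k) (b (Suc k)) \<le> d (b k) (a (Suc k))"
        using tp[OF block, of k] zk by (simp add: z_def dist_norm norm_minus_commute D G)
      moreover have "l * m * (x k)\<^sup>2 \<le> l * d (b k) (b (Suc k))"
        using lower[of "b k" "b (Suc k)"] l AC bB by (simp add: x_def norm_minus_commute mult.assoc)
      ultimately show ?thesis
        using rmin[OF aA, of k k] by (simp add: s_def)
    qed
    then have "open (ball bs \<delta> \<times> ball as \<delta>) \<and> p \<in> ball bs \<delta> \<times> ball as \<delta> \<and>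
        (\<forall>\<^sub>F k in sequentially. z k \<in> ball bs \<delta> \<times> ball as \<delta> \<longrightarrow> l * m * (x k)\<^sup>2 \<le> s k - s (Suc k))"
      using \<delta> by (auto simp: bsas intro!: open_Times)
    with l m show "\<exists>c>0. \<exists>N. open N \<and> p \<in> N \<and>
        (\<forall>\<^sub>F k in sequentially. z k \<in> N \<longrightarrow> c * (x k)\<^sup>2 \<le> s k - s (Suc k))"
      by (intro exI[of _ "l * m"]) auto
  next
    fix p assume p: "p \<in> accumulation_points z"
    obtain bs as where bsas: "p = (bs, as)" by (cases p)
    obtain W \<gamma> \<eta> \<phi> where W: "open W" "(bs, as) \<in> W" and \<gamma>: "0 < \<gamma>" and \<eta>: "0 < \<eta>"
      and \<phi>: "desingularizing \<eta> \<phi>"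
      and angle: "\<And>b a' b'. rl_block f A B b a' b' \<Longrightarrow> (b', a') \<in> W \<Longrightarrow>
        ereal (r\<^sup>2 / 2) < bregman f b' a' \<Longrightarrow> bregman f b' a' < ereal (r\<^sup>2 / 2 + \<eta>) \<Longrightarrow>
        \<gamma> \<le> (1 - cos (vec_angle (b - a') (b' - a')))
             / shrinking r \<phi> (real_of_ereal (left_dist f B a') - r\<^sup>2 / 2)"
      using assms(14)[of bs as] acc[OF p] unfolding rl_angle_condition_def bsas Let_def fst_conv snd_conv
      by metis
    \<comment> \<open>A lower bound for \<open>t * \<sigma> * g\<^sup>2\<close> below. For
      \<open>r > 0\<close> this product equals \<open>t\<close>, which exceeds
      \<open>r\<^sup>2 / 2\<close>; for \<open>r = 0\<close> the extra factor in the shrinking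
      function cancels \<open>t\<close> and leaves \<open>1\<close>.\<close>
    define \<kappa> where "\<kappa> = (if r > 0 then r\<^sup>2 / 2 else 1)"
    define e where "e = sqrt (2 * \<gamma> * \<kappa> / M)"
    have e: "0 < e" using \<gamma> M by (simp add: e_def \<kappa>_def)
    have slope: "e \<le> deriv \<phi> (s (Suc k)) * x k"
      if zk: "z k \<in> W" and pos: "0 < s (Suc k)" and less: "s (Suc k) < \<eta>" for k
    proof -
      define t where "t = d (b (Suc k)) (a (Suc k))"
      define \<sigma> where "\<sigma> = shrinking r \<phi> (s (Suc k))"
      define g where "g = deriv \<phi> (s (Suc k))"
      let ?u = "b k - a (Suc k)" and ?v = "b (Suc k) - a (Suc k)"
      have st: "s (Suc k) = t - r\<^sup>2 / 2" by (simp add: s_def t_def)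
      have g: "0 < g"
        using \<phi> pos less by (simp add: g_def desingularizing_def)
      have \<sigma>: "0 < \<sigma>"
        using g pos by (simp add: \<sigma>_def shrinking_def g_def)
      have \<kappa>: "\<kappa> \<le> t * \<sigma> * g\<^sup>2"
      proof (cases "r > 0")
        case True
        then have "\<sigma> * g\<^sup>2 = 1"
          using g by (simp add: \<sigma>_def shrinking_def g_def power_int_minus)
        with True pos show ?thesis by (simp add: \<kappa>_def st mult.assoc)
      next
        case False
        with r0 have "r = 0" by simp
        with g pos show ?thesis
          by (simp add: \<kappa>_def \<sigma>_def shrinking_def g_def st power_int_minus field_simps)
      qed
      have "left_dist f B (a (Suc k)) = ereal t"
        using left_dist_eq_if_left_proj[OF bP[of "Suc k"]] by (simp add: D G t_def)
      with angle[OF block, of k] zk pos less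
      have "\<gamma> \<le> (1 - cos (vec_angle ?u ?v)) / \<sigma>"
        by (simp add: z_def D G \<sigma>_def st flip: t_def)
      then have ang: "\<gamma> * \<sigma> \<le> 1 - cos (vec_angle ?u ?v)"
        using \<sigma> by (simp add: le_divide_eq)
      have "0 \<le> t"
        using pos zero_le_power2[of r] unfolding st by linarith
      then have t0: "0 \<le> t / M" using M by simp
      have "t / M \<le> (norm ?v)\<^sup>2"
        using upper[of "b (Suc k)" "a (Suc k)"] M AC aA bB by (simp add: t_def divide_le_eq mult.commute)
      \<comment> \<open>Since \<open>b (Suc k)\<close> is a left projection of
        \<open>a (Suc k)\<close>, the distance from \<open>b k\<close> is at least \<open>t\<close>
        as well.\<close>
      moreover have "t / M \<le> (norm ?u)\<^sup>2"
        using upper[of "b k" "a (Suc k)"] lmin[OF bB, of "Suc k" k] M AC aA bB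
        by (simp add: t_def divide_le_eq mult.commute)
      ultimately have "(t / M) * (t / M) \<le> (norm ?u)\<^sup>2 * (norm ?v)\<^sup>2"
        using t0 by (intro mult_mono) auto
      then have "(t / M)\<^sup>2 \<le> (norm ?u * norm ?v)\<^sup>2"
        by (simp add: power2_eq_square mult_ac)
      then have uv: "t / M \<le> norm ?u * norm ?v"
        by (rule power2_le_imp_le) simp
      \<comment> \<open>Here \<open>?u - ?v\<close> is \<open>b k - b (Suc k)\<close>, so the cosine
        estimate turns the angle bound into a lower bound for the step length.\<close>
      have "2 * (t / M) * (\<gamma> * \<sigma>) \<le> 2 * (norm ?u * norm ?v) * (1 - cos (vec_angle ?u ?v))"
        using uv ang t0 \<gamma> \<sigma> by (intro mult_mono) auto
      also have "\<dots> \<le> (x k)\<^sup>2"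
        using norm_diff_ge_vec_angle[of ?u ?v] by (simp add: x_def norm_minus_commute mult.assoc)
      finally have xk: "2 * (t / M) * (\<gamma> * \<sigma>) \<le> (x k)\<^sup>2" .
      have "e\<^sup>2 = 2 * \<gamma> / M * \<kappa>"
        using \<gamma> M by (simp add: e_def \<kappa>_def)
      also have "\<dots> \<le> 2 * \<gamma> / M * (t * \<sigma> * g\<^sup>2)"
        using \<kappa> \<gamma> M by (intro mult_left_mono) auto
      also have "\<dots> = 2 * (t / M) * (\<gamma> * \<sigma>) * g\<^sup>2"
        by simp
      also have "\<dots> \<le> (x k)\<^sup>2 * g\<^sup>2"
        using xk by (rule mult_right_mono) simp
      also have "\<dots> = (g * x k)\<^sup>2"
        by (simp add: power_mult_distrib)
      finally show ?thesis
        unfolding g_def[symmetric] by (rule power2_le_imp_le) (use g in \<open>simp add: x_def\<close>)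
    qed
    \<comment> \<open>Convergence of \<open>s\<close> to \<open>0\<close> eventually provides the
      upper restriction on the values in the angle condition.\<close>
    have "\<forall>\<^sub>F k in sequentially. s (Suc k) < \<eta>"
      using LIMSEQ_Suc[OF s_lim] \<eta> by (rule order_tendstoD)
    then have "\<forall>\<^sub>F k in sequentially. z k \<in> W \<longrightarrow> 0 < s (Suc k) \<longrightarrow> e \<le> deriv \<phi> (s (Suc k)) * x k"
      by eventually_elim (use slope in blast)
    with e \<eta> \<phi> W show "\<exists>e>0. \<exists>\<eta>>0. \<exists>\<phi>. desingularizing \<eta> \<phi> \<and> (\<exists>N. open N \<and> p \<in> N \<and>
        (\<forall>\<^sub>F k in sequentially. z k \<in> N \<longrightarrow> 0 < s (Suc k) \<longrightarrow> e \<le> deriv \<phi> (s (Suc k)) * x k))"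
      unfolding bsas by blast
  qed
  then show "convergent b"
    unfolding x_def by (rule convergent_if_summable_steps)
qed

end
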